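(* For any real functions $\psi$ and $f$ defined on $E$, the estimator $I_n(f,\psi)$ of $\langle\pi,f\rangle$ is asymptotically normal: $$\sqrt n\,\big(I_n(f,\psi)-\langle\pi,f\rangle\big)\xrightarrow[n\to\infty]{(d)}\mathcal N(0,\sigma(f,\psi)^2),$$ with asymptotic variance $\sigma(f,\psi)^2$ given by $$\sigma(f,\psi)^2=\sigma(f)^2-\mathbb E_\pi\Big[(1-\rho(X_0,X_1))(F(X_1)-F(X_0))^2\Big]+\mathbb E_\pi\Big[(1-\rho(X_0,X_1))\big(\psi(X_1)-F(X_1)-\psi(X_0)+F(X_0)\big)^2\Big],$$ where $F$ solves the Poisson equation $F-PF=f-\langle\pi,f\rangle$ on $E$. In particular, for fixed $f$, the asymptotic variance $\sigma(f,\psi)^2$ is minimal (over real functions $\psi$ on $E$) for $\psi=F$, and this choice achieves variance reduction: $\sigma(f,F)^2\le\sigma(f)^2$.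
   Context: Let $E$ be a finite set and $\pi$ a probability measure on $E$ with $\pi(x)>0$ for all $x\in E$; write $\langle\pi,h\rangle=\sum_{x\in E}\pi(x)h(x)$. Let $Q$ be an irreducible transition matrix on $E$ such that for all $x,y\in E$, $Q(x,y)=0$ implies $Q(y,x)=0$. For $x,y\in E$ with $Q(x,y)>0$ let $(\rho(x,y),\rho(y,x))\in(0,1]^2$ satisfy $\rho(x,y)\pi(x)Q(x,y)=\rho(y,x)\pi(y)Q(y,x)$. Metropolis-Hastings chain: $X_0$ has an arbitrary distribution $\nu_0$ on $E$. Given $X_0,\dots,X_n$ (and the past proposals), the proposal $\tilde X_{n+1}$ is distributed according to $Q(X_n,\cdot)$; with probability $\rho(X_n,\tilde X_{n+1})$ it is accepted and $X_{n+1}=\tilde X_{n+1}$, otherwise $X_{n+1}=X_n$. The chain $X$ has transition matrix $P(x,y)=Q(x,y)\rho(x,y)$ for $x\ne y$, $P(x,x)=1-\sum_{z\neq x}P(x,z)$, and is reversible with respect to $\pi$. Write $Ph(x)=\sum_{y\in E}P(x,y)h(y)$. $\mathbb E_\pi$ denotes expectation when $X_0$ has distribution $\pi$. (Terms in $\mathbb E_\pi[\cdot]$ with $X_1=X_0$ vanish, so values of $\rho$ on the diagonal are irrelevant there.) For real functions $f,\psi$ on $E$ and $n\ge 1$ define $$I_n(f)=\frac1n\sum_{k=1}^n f(X_k),$$ $$J_n(\psi)=\frac1n\sum_{k=0}^{n-1}\Big(\rho(X_k,\tilde X_{k+1})\psi(\tilde X_{k+1})+(1-\rho(X_k,\tilde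 X_{k+1}))\psi(X_k)-\psi(X_{k+1})\Big),$$ $$I_n(f,\psi)=I_n(f)+J_n(\psi).$$ The solution $F$ of the Poisson equation is unique up to an additive constant, and $\sigma(f)^2=\langle\pi,F^2\rangle-\langle\pi,(PF)^2\rangle$ (the asymptotic variance of $I_n(f)$). $\mathcal N(0,s^2)$ is the Gaussian distribution with mean $0$ and variance $s^2$ (possibly $s^2=0$). *)

theory Defs
  imports "HOL-Probability.Probability"
begin

text \<open>
  The finite set \<open>E\<close> is a type of class \<open>finite\<close>, the target law \<open>\<pi>\<close> a pmf on it, and the
  proposal matrix \<open>Q\<close> is given by its rows, \<open>Q(x,y) = pmf (Q x) y\<close>.  The acceptance
  probability \<open>\<rho>\<close> is a total function whose values are unconstrained (and irrelevant)
  where \<open>Q(x,y) = 0\<close>.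
\<close>

definition irreducible_kernel :: "('e \<Rightarrow> 'e pmf) \<Rightarrow> bool" where
  "irreducible_kernel K \<longleftrightarrow> (\<forall>x y. (\<lambda>u v. 0 < pmf (K u) v)\<^sup>*\<^sup>* x y)"

locale mh_setting =
  fixes \<pi> :: "'e::finite pmf"
    and Q :: "'e \<Rightarrow> 'e pmf"
    and \<rho> :: "'e \<Rightarrow> 'e \<Rightarrow> real"
  assumes target_pos: "\<And>x. 0 < pmf \<pi> x"
    and irreducible: "irreducible_kernel Q"
    and support_sym: "\<And>x y. pmf (Q x) y = 0 \<Longrightarrow> pmf (Q y) x = 0"
    and acceptance_range: "\<And>x y. 0 < pmf (Q x) y \<Longrightarrow> 0 < \<rho> x y \<and> \<rho> x y \<le> 1"
    and balance: "\<And>x y. 0 < pmf (Q x) y \<Longrightarrow>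
      \<rho> x y * pmf \<pi> x * pmf (Q x) y = \<rho> y x * pmf \<pi> y * pmf (Q y) x"

text \<open>Law of the next state, given the current state \<open>x\<close> and the proposal \<open>y\<close>.\<close>

definition mh_accept :: "('e \<Rightarrow> 'e \<Rightarrow> real) \<Rightarrow> 'e \<Rightarrow> 'e \<Rightarrow> 'e pmf" where
  "mh_accept \<rho> x y = map_pmf (\<lambda>accepted. if accepted then y else x) (bernoulli_pmf (\<rho> x y))"

definition mh_history ::
  "(nat \<Rightarrow> 'w \<Rightarrow> 'e) \<Rightarrow> (nat \<Rightarrow> 'w \<Rightarrow> 'e) \<Rightarrow> nat \<Rightarrow> (nat \<Rightarrow> 'e) \<Rightarrow> (nat \<Rightarrow> 'e) \<Rightarrow> 'w \<Rightarrow> bool" where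
  "mh_history X Xt n x y \<omega> \<longleftrightarrow> (\<forall>k\<le>n. X k \<omega> = x k) \<and> (\<forall>k\<in>{1..n}. Xt k \<omega> = y k)"

text \<open>
  \<open>Xt n\<close> for \<open>n \<ge> 1\<close> is the proposal made at step \<open>n\<close>; \<open>Xt 0\<close> plays no role.  The law of
  \<open>X 0\<close> is arbitrary.
\<close>

locale mh_chain = prob_space M
  for M :: "'w measure"
    and Q :: "'e::finite \<Rightarrow> 'e pmf"
    and \<rho> :: "'e \<Rightarrow> 'e \<Rightarrow> real"
    and X :: "nat \<Rightarrow> 'w \<Rightarrow> 'e"
    and Xt :: "nat \<Rightarrow> 'w \<Rightarrow> 'e" +
  assumes measurable_state: "\<And>n. X n \<in> measurable M (count_space UNIV)"
    and measurable_proposal: "\<And>n. Xt (Suc n) \<in> measurable M (count_space UNIV)"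
    and proposal_law: "\<And>n x y z.
      0 < \<P>(\<omega> in M. mh_history X Xt n x y \<omega>) \<Longrightarrow>
      \<P>(\<omega> in M. Xt (Suc n) \<omega> = z \<bar> mh_history X Xt n x y \<omega>) = pmf (Q (x n)) z"
    and acceptance_law: "\<And>n x y z x'.
      0 < \<P>(\<omega> in M. mh_history X Xt n x y \<omega> \<and> Xt (Suc n) \<omega> = z) \<Longrightarrow>
      \<P>(\<omega> in M. X (Suc n) \<omega> = x' \<bar> mh_history X Xt n x y \<omega> \<and> Xt (Suc n) \<omega> = z)
        = pmf (mh_accept \<rho> (x n) z) x'"

definition mean :: "'e::finite pmf \<Rightarrow> ('e \<Rightarrow> real) \<Rightarrow> real" where
  "mean \<pi> h = (\<Sum>x\<in>UNIV. pmf \<pi> x * h x)"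

definition mh_matrix :: "('e::finite \<Rightarrow> 'e pmf) \<Rightarrow> ('e \<Rightarrow> 'e \<Rightarrow> real) \<Rightarrow> 'e \<Rightarrow> 'e \<Rightarrow> real" where
  "mh_matrix Q \<rho> x y =
     (if x = y then 1 - (\<Sum>z\<in>UNIV - {x}. pmf (Q x) z * \<rho> x z) else pmf (Q x) y * \<rho> x y)"

definition mh_op ::
  "('e::finite \<Rightarrow> 'e pmf) \<Rightarrow> ('e \<Rightarrow> 'e \<Rightarrow> real) \<Rightarrow> ('e \<Rightarrow> real) \<Rightarrow> 'e \<Rightarrow> real" where
  "mh_op Q \<rho> h x = (\<Sum>y\<in>UNIV. mh_matrix Q \<rho> x y * h y)"

definition poisson_solution ::
  "'e::finite pmf \<Rightarrow> ('e \<Rightarrow> 'e pmf) \<Rightarrow> ('e \<Rightarrow> 'e \<Rightarrow> real) \<Rightarrow> ('e \<Rightarrow> real) \<Rightarrow> ('e \<Rightarrow> real) \<Rightarrow> bool" where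
  "poisson_solution \<pi> Q \<rho> f F \<longleftrightarrow> (\<forall>x. F x - mh_op Q \<rho> F x = f x - mean \<pi> f)"

text \<open>The joint law of \<open>(X 0, X 1)\<close> when \<open>X 0\<close> has law \<open>\<pi>\<close>.\<close>

definition mh_first_step ::
  "'e pmf \<Rightarrow> ('e \<Rightarrow> 'e pmf) \<Rightarrow> ('e \<Rightarrow> 'e \<Rightarrow> real) \<Rightarrow> ('e \<times> 'e) pmf" where
  "mh_first_step \<pi> Q \<rho> =
     bind_pmf \<pi> (\<lambda>x0. bind_pmf (Q x0) (\<lambda>y. map_pmf (\<lambda>x1. (x0, x1)) (mh_accept \<rho> x0 y)))"

text \<open>
  \<open>\<sigma>(f)\<^sup>2\<close> and \<open>\<sigma>(f,\<psi>)\<^sup>2\<close>; both depend on \<open>f\<close> only through a solution \<open>F\<close> of its Poisson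
  equation.
\<close>

definition mh_var ::
  "'e::finite pmf \<Rightarrow> ('e \<Rightarrow> 'e pmf) \<Rightarrow> ('e \<Rightarrow> 'e \<Rightarrow> real) \<Rightarrow> ('e \<Rightarrow> real) \<Rightarrow> real" where
  "mh_var \<pi> Q \<rho> F = mean \<pi> (\<lambda>x. (F x)\<^sup>2) - mean \<pi> (\<lambda>x. (mh_op Q \<rho> F x)\<^sup>2)"

definition mh_cv_var ::
  "'e::finite pmf \<Rightarrow> ('e \<Rightarrow> 'e pmf) \<Rightarrow> ('e \<Rightarrow> 'e \<Rightarrow> real) \<Rightarrow> ('e \<Rightarrow> real) \<Rightarrow> ('e \<Rightarrow> real) \<Rightarrow> real" where
  "mh_cv_var \<pi> Q \<rho> F \<psi> = mh_var \<pi> Q \<rho> F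
     - measure_pmf.expectation (mh_first_step \<pi> Q \<rho>)
         (\<lambda>(x0, x1). (1 - \<rho> x0 x1) * (F x1 - F x0)\<^sup>2)
     + measure_pmf.expectation (mh_first_step \<pi> Q \<rho>)
         (\<lambda>(x0, x1). (1 - \<rho> x0 x1) * (\<psi> x1 - F x1 - \<psi> x0 + F x0)\<^sup>2)"

definition mh_I :: "(nat \<Rightarrow> 'w \<Rightarrow> 'e) \<Rightarrow> ('e \<Rightarrow> real) \<Rightarrow> nat \<Rightarrow> 'w \<Rightarrow> real" where
  "mh_I X f n \<omega> = (\<Sum>k=1..n. f (X k \<omega>)) / real n"

definition mh_J ::
  "('e \<Rightarrow> 'e \<Rightarrow> real) \<Rightarrow> (nat \<Rightarrow> 'w \<Rightarrow> 'e) \<Rightarrow> (nat \<Rightarrow> 'w \<Rightarrow> 'e) \<Rightarrow> ('e \<Rightarrow> real) \<Rightarrow> nat \<Rightarrow> 'w \<Rightarrow> real" where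
  "mh_J \<rho> X Xt \<psi> n \<omega> =
     (\<Sum>k<n. \<rho> (X k \<omega>) (Xt (Suc k) \<omega>) * \<psi> (Xt (Suc k) \<omega>)
           + (1 - \<rho> (X k \<omega>) (Xt (Suc k) \<omega>)) * \<psi> (X k \<omega>) - \<psi> (X (Suc k) \<omega>)) / real n"

definition mh_I_cv ::
  "('e \<Rightarrow> 'e \<Rightarrow> real) \<Rightarrow> (nat \<Rightarrow> 'w \<Rightarrow> 'e) \<Rightarrow> (nat \<Rightarrow> 'w \<Rightarrow> 'e) \<Rightarrow> ('e \<Rightarrow> real) \<Rightarrow> ('e \<Rightarrow> real)
    \<Rightarrow> nat \<Rightarrow> 'w \<Rightarrow> real" where
  "mh_I_cv \<rho> X Xt f \<psi> n \<omega> = mh_I X f n \<omega> + mh_J \<rho> X Xt \<psi> n \<omega>"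

text \<open>
  The Gaussian law with mean \<open>m\<close> and variance \<open>v \<ge> 0\<close>, a point mass if \<open>v = 0\<close>.  Note that
  \<^const>\<open>normal_density\<close> takes the standard deviation.
\<close>

definition gaussian :: "real \<Rightarrow> real \<Rightarrow> real measure" where
  "gaussian m v =
     (if v = 0 then return borel m else density lborel (\<lambda>x. ennreal (normal_density m (sqrt v) x)))"

end

theory Submission
  imports Defs "HOL-Real_Asymp.Real_Asymp"
begin

text \<open>
  By the Poisson equation, \<open>n (I\<^sub>n(f,\<psi>) - \<langle>\<pi>,f\<rangle>)\<close> is a martingale, whose increments are functions of
  \<open>(X\<^sub>k, Xt\<^sub>k\<^sub>+\<^sub>1, X\<^sub>k\<^sub>+\<^sub>1)\<close>, plus the bounded term \<open>PF(X\<^sub>0) - PF(X\<^sub>n)\<close>.  Conditioning on the proposal first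
  shows that the conditional variance \<open>v\<close> of the increments satisfies \<open>\<langle>\<pi>,v\<rangle> = \<sigma>(f,\<psi>)\<^sup>2\<close>.  The central limit
  theorem for the martingale \<open>S\<^sub>n\<close> is obtained from characteristic functions without spectral theory:
  if \<open>w\<close> solves the Poisson equation for \<open>v\<close>, then \<open>h = 1 - u\<^sup>2 w / 2\<close> is, up to \<open>O(u\<^sup>3)\<close>, an eigenfunction with
  eigenvalue \<open>1 - u\<^sup>2 \<sigma>(f,\<psi>)\<^sup>2 / 2\<close> of the operator that takes \<open>h\<close> to the conditional mean of
  \<open>exp (i u (S\<^sub>k\<^sub>+\<^sub>1 - S\<^sub>k)) h(X\<^sub>k\<^sub>+\<^sub>1)\<close>.  Hence \<open>E exp (i u S\<^sub>n) = (1 - u\<^sup>2 \<sigma>(f,\<psi>)\<^sup>2 / 2)\<^sup>n + O(u\<^sup>2 + n u\<^sup>3)\<close>, and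
  \<open>u = t / sqrt n\<close> gives the Gaussian limit.
\<close>

text \<open>Mean, over one step from \<open>x\<close>, of \<open>G\<close> evaluated at the proposal and at the next state.\<close>

definition step_mean ::
  "('e::finite \<Rightarrow> 'e pmf) \<Rightarrow> ('e \<Rightarrow> 'e \<Rightarrow> real) \<Rightarrow> ('e \<Rightarrow> 'e \<Rightarrow> 'a::real_vector) \<Rightarrow> 'e \<Rightarrow> 'a" where
  "step_mean Q \<rho> G x =
     (\<Sum>y\<in>UNIV. pmf (Q x) y *\<^sub>R (\<rho> x y *\<^sub>R G y y + (1 - \<rho> x y) *\<^sub>R G y x))"

section \<open>Algebra of one-step means and of the operator \<open>P\<close>\<close>

lemma sum_pmf_UNIV [simp]: "(\<Sum>y\<in>UNIV. pmf p y) = 1" for p :: "'e::finite pmf"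
  by (rule sum_pmf_eq_1) auto

lemma step_mean_add:
  "step_mean Q \<rho> (\<lambda>y x'. G y x' + H y x') x = step_mean Q \<rho> G x + step_mean Q \<rho> H x"
  by (simp add: step_mean_def scaleR_add_right sum.distrib ac_simps)

text \<open>A general linear \<open>h\<close> covers both real scaling and the embeddings of real
  values into the complex numbers that the characteristic function needs.\<close>

lemma step_mean_linear:
  assumes "linear h"
  shows "step_mean Q \<rho> (\<lambda>y x'. h (G y x')) x = h (step_mean Q \<rho> G x)"
  by (simp add: step_mean_def linear_sum[OF assms] linear_cmul[OF assms] linear_add[OF assms])

lemma step_mean_const: "step_mean Q \<rho> (\<lambda>y x'. c) x = c"
  by (simp add: step_mean_def flip: scaleR_add_left scaleR_left.sum)

text \<open>The diagonal entry of \<open>mh_matrix\<close> is the mass left over by accepted moves,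
  so \<open>P\<close> is the identity plus the mean effect of accepted moves. The term
  \<open>y = x\<close> vanishes, so the sum may run over all of \<open>UNIV\<close>.\<close>

lemma mh_op_eq: "mh_op Q \<rho> h x = h x + (\<Sum>y\<in>UNIV. pmf (Q x) y * \<rho> x y * (h y - h x))"
proof -
  have "mh_op Q \<rho> h x = mh_matrix Q \<rho> x x * h x + (\<Sum>y\<in>UNIV - {x}. pmf (Q x) y * \<rho> x y * h y)"
    unfolding mh_op_def by (subst sum.remove[of _ x]) (auto simp: mh_matrix_def intro!: sum.cong)
  also have "\<dots> = h x + (\<Sum>y\<in>UNIV - {x}. pmf (Q x) y * \<rho> x y * (h y - h x))"
    by (simp add: mh_matrix_def algebra_simps sum_subtractf sum_distrib_left)
  also have "\<dots> = h x + (\<Sum>y\<in>UNIV. pmf (Q x) y * \<rho> x y * (h y - h x))"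
    by (subst (2) sum.remove[of _ x]) auto
  finally show ?thesis .
qed

text \<open>Links the matrix \<open>P\<close> to the two-stage mechanism: a rejection leaves
  \<open>h x\<close>, an acceptance adds \<open>h y - h x\<close>.\<close>

lemma mh_op_eq_step_mean: "mh_op Q \<rho> h x = step_mean Q \<rho> (\<lambda>y x'. h x') x"
proof -
  have "mh_op Q \<rho> h x = (\<Sum>y\<in>UNIV. pmf (Q x) y * h x)
      + (\<Sum>y\<in>UNIV. pmf (Q x) y * \<rho> x y * (h y - h x))"
    by (simp add: mh_op_eq flip: sum_distrib_right)
  then show ?thesis
    by (simp add: step_mean_def algebra_simps flip: sum.distrib)
qed

lemma mh_op_add: "mh_op Q \<rho> (\<lambda>x. g x + h x) x = mh_op Q \<rho> g x + mh_op Q \<rho> h x"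
  by (simp add: mh_op_def sum.distrib algebra_simps)

lemma mh_op_scale: "mh_op Q \<rho> (\<lambda>x. c * h x) x = c * mh_op Q \<rho> h x"
  by (simp add: mh_op_def sum_distrib_left algebra_simps)

lemma mean_add: "mean \<pi> (\<lambda>x. g x + h x) = mean \<pi> g + mean \<pi> h"
  by (simp add: mean_def sum.distrib algebra_simps)

lemma mean_diff: "mean \<pi> (\<lambda>x. g x - h x) = mean \<pi> g - mean \<pi> h"
  by (simp add: mean_def sum_subtractf algebra_simps)

lemma mean_scale: "mean \<pi> (\<lambda>x. c * h x) = c * mean \<pi> h"
  by (simp add: mean_def sum_distrib_left algebra_simps)

lemma mean_const: "mean \<pi> (\<lambda>x. c) = c"
  by (simp add: mean_def flip: sum_distrib_right)

lemma mean_nonneg: "(\<And>x. 0 \<le> h x) \<Longrightarrow> 0 \<le> mean \<pi> h"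
  by (simp add: mean_def sum_nonneg)

subsection \<open>Reversibility and the Poisson equation\<close>

text \<open>Only products with \<open>pmf (Q x) y\<close> have a guaranteed sign, since
  \<open>\<rho> x y\<close> is unconstrained where the proposal has probability zero.\<close>

lemma (in mh_setting) accept_weight_nonneg: "0 \<le> pmf (Q x) y * \<rho> x y"
  using acceptance_range[of x y] by (cases "pmf (Q x) y = 0") (auto simp: order.strict_iff_order)

lemma (in mh_setting) reject_weight_nonneg: "0 \<le> pmf (Q x) y * (1 - \<rho> x y)"
  using acceptance_range[of x y] by (cases "pmf (Q x) y = 0") (auto simp: order.strict_iff_order)

text \<open>Extends the balance condition to all pairs: off the support of \<open>Q\<close> both
  sides vanish, because that support is symmetric.\<close>

lemma (in mh_setting) detailed_balance:
  "pmf \<pi> x * (pmf (Q x) y * \<rho> x y) = pmf \<pi> y * (pmf (Q y) x * \<rho> y x)"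
proof (cases "pmf (Q x) y = 0")
  case True
  then show ?thesis using support_sym[of x y] by simp
next
  case False
  then show ?thesis using balance[of x y] by (simp add: order.strict_iff_order mult_ac)
qed

text \<open>Invariance from reversibility: exchanging the two summation indices shows that accepted
  moves leave the mean of \<open>h\<close> unchanged.\<close>

lemma (in mh_setting) mean_mh_op: "mean \<pi> (mh_op Q \<rho> h) = mean \<pi> h"
proof -
  let ?a = "\<lambda>x y. pmf \<pi> x * (pmf (Q x) y * \<rho> x y)"
  have "(\<Sum>x\<in>UNIV. \<Sum>y\<in>UNIV. ?a x y * h y) = (\<Sum>x\<in>UNIV. \<Sum>y\<in>UNIV. ?a x y * h x)"
    by (subst sum.swap) (simp add: detailed_balance)
  then have "(\<Sum>x\<in>UNIV. \<Sum>y\<in>UNIV. ?a x y * (h y - h x)) = 0"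
    by (simp add: right_diff_distrib sum_subtractf)
  then show ?thesis
    by (simp add: mean_def mh_op_eq distrib_left sum.distrib sum_distrib_left mult.assoc)
qed

text \<open>Maximum principle: a harmonic function is constant along every edge of \<open>Q\<close> leaving a maximiser.\<close>

lemma (in mh_setting) harmonic_const:
  assumes harm: "\<And>x. mh_op Q \<rho> h x = h x"
  shows "h x = h y"
proof -
  have "Max (range h) \<in> range h" by (rule Max_in) auto
  then obtain m where "h m = Max (range h)" by (metis rangeE)
  then have m: "h y \<le> h m" for y by simp
  have step: "h v = h m" if u: "h u = h m" and uv: "0 < pmf (Q u) v" for u v
  proof -
    \<comment> \<open>Harmonicity at a maximiser is a vanishing sum of nonnegative terms. Acceptance
      is positive along edges of \<open>Q\<close>, so irreducibility of \<open>Q\<close> propagates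
      the maximum everywhere.\<close>
    have "(\<Sum>y\<in>UNIV. pmf (Q u) y * \<rho> u y * (h m - h y)) = 0"
      using harm[of u] u by (simp add: mh_op_eq algebra_simps sum_subtractf)
    then have "pmf (Q u) v * \<rho> u v * (h m - h v) = 0"
      by (subst (asm) sum_nonneg_eq_0_iff)
        (auto intro!: mult_nonneg_nonneg simp: accept_weight_nonneg m)
    then show ?thesis using uv acceptance_range[OF uv] by auto
  qed
  have "h y = h m" for y
  proof -
    have "(\<lambda>u v. 0 < pmf (Q u) v)\<^sup>*\<^sup>* m y"
      using irreducible by (simp add: irreducible_kernel_def)
    then show ?thesis by induction (auto intro: step)
  qed
  then show ?thesis by metis
qed

text \<open>Adding the projection onto the constants turns \<open>I - P\<close> into an injective, hence
  surjective, operator.\<close>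

lemma (in mh_setting) poisson_solvable: "\<exists>F. poisson_solution \<pi> Q \<rho> f F"
proof -
  define A :: "real ^ 'e \<Rightarrow> real ^ 'e" where
    "A F = (\<chi> x. F $ x - mh_op Q \<rho> (($) F) x + mean \<pi> (($) F))" for F
  have comp: "($) (F + G) = (\<lambda>x. F $ x + G $ x)" "($) (c *\<^sub>R F) = (\<lambda>x. c * F $ x)"
    for F G :: "real ^ 'e" and c
    by auto
  have lin: "linear A"
    by (rule linearI)
      (simp_all only: A_def vec_eq_iff comp mh_op_add mh_op_scale mean_add mean_scale
        vec_lambda_beta vector_add_component vector_scaleR_component real_scaleR_def,
        simp_all add: algebra_simps)
  \<comment> \<open>By invariance the means of \<open>F\<close> and \<open>PF\<close> cancel, and
    only the added projection remains. This is used twice: on the kernel of \<open>A\<close>, and on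
    a preimage of the centred \<open>f\<close>, where it makes the projection term drop out.\<close>
  have mean_A: "mean \<pi> (($) (A F)) = mean \<pi> (($) F)" for F
  proof -
    have "($) (A F) = (\<lambda>x. F $ x - mh_op Q \<rho> (($) F) x + mean \<pi> (($) F))"
      by (auto simp: A_def)
    then show ?thesis
      using mean_mh_op[of "($) F"] by (simp only: mean_add mean_diff mean_const)
  qed
  have "F = 0" if "A F = 0" for F
  proof -
    have "($) (0 :: real ^ 'e) = (\<lambda>x. 0)" by auto
    then have 0: "mean \<pi> (($) F) = 0" using mean_A[of F] that by (simp add: mean_const)
    have "mh_op Q \<rho> (($) F) x = F $ x" for x
      using that 0 by (simp add: A_def vec_eq_iff)
    then have *: "F $ x = F $ y" for x y by (rule harmonic_const)
    have "mean \<pi> (($) F) = F $ x" for x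
    proof -
      have "($) F = (\<lambda>y. F $ x)" using * by blast
      then show ?thesis by (metis mean_const)
    qed
    with 0 show ?thesis by (simp add: vec_eq_iff)
  qed
  then have "inj A" using lin linear_injective_0 by blast
  then have "surj A" using lin linear_inj_imp_surj by blast
  then obtain F where F: "A F = (\<chi> x. f x - mean \<pi> f)" by (metis surjD)
  then have "($) (A F) = (\<lambda>x. f x - mean \<pi> f)" by auto
  then have "mean \<pi> (($) F) = 0"
    using mean_A[of F] by (simp only: mean_diff mean_const)
  then have "poisson_solution \<pi> Q \<rho> f (($) F)"
    using F by (simp add: A_def vec_eq_iff poisson_solution_def)
  then show ?thesis by blast
qed

subsection \<open>Martingale increments and the asymptotic variance\<close>

text \<open>The arguments \<open>x\<close>, \<open>y\<close>, \<open>x'\<close> are the current state, the proposal and the next state.\<close>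

definition mh_increment ::
  "('e::finite \<Rightarrow> 'e pmf) \<Rightarrow> ('e \<Rightarrow> 'e \<Rightarrow> real) \<Rightarrow> ('e \<Rightarrow> real) \<Rightarrow> ('e \<Rightarrow> real) \<Rightarrow> 'e \<Rightarrow> 'e \<Rightarrow> 'e \<Rightarrow> real"
  where
  "mh_increment Q \<rho> F \<psi> x y x' =
     F x' - mh_op Q \<rho> F x + (\<rho> x y * \<psi> y + (1 - \<rho> x y) * \<psi> x - \<psi> x')"

text \<open>The martingale property. The \<open>\<psi>\<close> part has mean zero already given the
  proposal, since it compares \<open>\<psi> x'\<close> with its mean over the acceptance decision;
  the rest is \<open>F x'\<close> minus its one-step mean.\<close>

lemma step_mean_increment: "step_mean Q \<rho> (mh_increment Q \<rho> F \<psi> x) x = 0"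
proof -
  have "step_mean Q \<rho> (mh_increment Q \<rho> F \<psi> x) x
    = step_mean Q \<rho> (\<lambda>y x'. F x' + - mh_op Q \<rho> F x) x"
    by (simp add: step_mean_def mh_increment_def algebra_simps)
  also have "\<dots> = 0"
    by (simp only: step_mean_add step_mean_const) (simp add: mh_op_eq_step_mean)
  finally show ?thesis .
qed

text \<open>Condition on the proposal. The acceptance decision contributes a Bernoulli variance with
  factor \<open>\<rho> x y * (1 - \<rho> x y)\<close>; relative to the increment
  \<open>F x' - PF(x)\<close>, the control variate replaces the jump \<open>F y - F x\<close> in it
  by the jump of \<open>\<psi> - F\<close>.\<close>

lemma step_mean_increment_sq:
  "step_mean Q \<rho> (\<lambda>y x'. (mh_increment Q \<rho> F \<psi> x y x')\<^sup>2) x =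
     mh_op Q \<rho> (\<lambda>x. (F x)\<^sup>2) x - (mh_op Q \<rho> F x)\<^sup>2
     - (\<Sum>y\<in>UNIV. pmf (Q x) y * \<rho> x y * ((1 - \<rho> x y) * (F y - F x)\<^sup>2))
     + (\<Sum>y\<in>UNIV. pmf (Q x) y * \<rho> x y * ((1 - \<rho> x y) * (\<psi> y - F y - \<psi> x + F x)\<^sup>2))"
proof -
  let ?p = "mh_op Q \<rho> F x"
  let ?q = "\<lambda>y. pmf (Q x) y"
  have "step_mean Q \<rho> (\<lambda>y x'. (mh_increment Q \<rho> F \<psi> x y x')\<^sup>2) x =
    (\<Sum>y\<in>UNIV. ?q y * (\<rho> x y * (F y)\<^sup>2 + (1 - \<rho> x y) * (F x)\<^sup>2)
       + - 2 * ?p * (?q y * (\<rho> x y * F y + (1 - \<rho> x y) * F x)) + ?p\<^sup>2 * ?q y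
       - ?q y * \<rho> x y * ((1 - \<rho> x y) * (F y - F x)\<^sup>2)
       + ?q y * \<rho> x y * ((1 - \<rho> x y) * (\<psi> y - F y - \<psi> x + F x)\<^sup>2))"
    unfolding step_mean_def mh_increment_def real_scaleR_def
    by (rule sum.cong) (auto simp: power2_eq_square algebra_simps)
  also have "\<dots> = mh_op Q \<rho> (\<lambda>x. (F x)\<^sup>2) x + - 2 * ?p * ?p + ?p\<^sup>2
     - (\<Sum>y\<in>UNIV. ?q y * \<rho> x y * ((1 - \<rho> x y) * (F y - F x)\<^sup>2))
     + (\<Sum>y\<in>UNIV. ?q y * \<rho> x y * ((1 - \<rho> x y) * (\<psi> y - F y - \<psi> x + F x)\<^sup>2))"
    unfolding sum.distrib sum_subtractf sum_distrib_left[symmetric]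
    by (simp add: mh_op_eq_step_mean step_mean_def)
  finally show ?thesis by (simp add: power2_eq_square)
qed

text \<open>A rejection gives \<open>x1 = x0\<close>, where \<open>g\<close> vanishes, so only
  accepted moves contribute.\<close>

lemma (in mh_setting) expectation_first_step:
  assumes "\<And>x. g x x = (0::real)"
  shows "measure_pmf.expectation (mh_first_step \<pi> Q \<rho>) (\<lambda>(x0, x1). g x0 x1)
    = mean \<pi> (\<lambda>x. \<Sum>y\<in>UNIV. pmf (Q x) y * \<rho> x y * g x y)"
proof -
  \<comment> \<open>The success probability of \<open>bernoulli_pmf\<close> is
    \<open>\<rho> x y\<close> only for values in [0,1]; the factor \<open>pmf (Q x) y\<close> covers
    the other pairs.\<close>
  have accept: "pmf (Q x) y * measure_pmf.expectation (mh_accept \<rho> x y) (g x)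
      = pmf (Q x) y * \<rho> x y * g x y" for x y
  proof (cases "pmf (Q x) y = 0")
    case False
    then have "0 \<le> \<rho> x y" "\<rho> x y \<le> 1"
      using acceptance_range[of x y] by (auto simp: order.strict_iff_order)
    then show ?thesis by (simp add: mh_accept_def assms)
  qed simp
  have inner: "measure_pmf.expectation (bind_pmf (Q x) (\<lambda>y. map_pmf (Pair x) (mh_accept \<rho> x y)))
      (\<lambda>(x0, x1). g x0 x1)
    = (\<Sum>y\<in>UNIV. pmf (Q x) y * measure_pmf.expectation (mh_accept \<rho> x y) (g x))" for x
    by (subst pmf_expectation_bind[where A = UNIV]) auto
  have "measure_pmf.expectation (mh_first_step \<pi> Q \<rho>) (\<lambda>(x0, x1). g x0 x1)
    = (\<Sum>x\<in>UNIV. pmf \<pi> x * (\<Sum>y\<in>UNIV. pmf (Q x) y *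
         measure_pmf.expectation (mh_accept \<rho> x y) (g x)))"
    unfolding mh_first_step_def inner[symmetric]
    by (subst pmf_expectation_bind[where A = UNIV]) auto
  also have "\<dots> = (\<Sum>x\<in>UNIV. pmf \<pi> x * (\<Sum>y\<in>UNIV. pmf (Q x) y * \<rho> x y * g x y))"
    by (simp add: accept)
  finally show ?thesis by (simp add: mean_def)
qed

text \<open>Averaging the conditional second moment over \<open>\<pi>\<close>: invariance turns the
  mean of \<open>P(F^2)\<close> into that of \<open>F^2\<close>, and the two sums become
  expectations over the first step.\<close>

lemma (in mh_setting) mh_cv_var_eq:
  "mh_cv_var \<pi> Q \<rho> F \<psi> =
     mean \<pi> (\<lambda>x. step_mean Q \<rho> (\<lambda>y x'. (mh_increment Q \<rho> F \<psi> x y x')\<^sup>2) x)"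
  unfolding step_mean_increment_sq mean_add mean_diff mean_mh_op[of "\<lambda>x. (F x)\<^sup>2"]
    mh_cv_var_def mh_var_def
  by (subst (1 2) expectation_first_step) auto

lemma (in mh_setting) step_mean_nonneg:
  fixes G :: "'e \<Rightarrow> 'e \<Rightarrow> real"
  assumes "\<And>y x'. 0 \<le> G y x'"
  shows "0 \<le> step_mean Q \<rho> G x"
  unfolding step_mean_def
  by (intro sum_nonneg)
    (simp add: distrib_left accept_weight_nonneg reject_weight_nonneg assms flip: mult.assoc)

text \<open>The acceptance and rejection weights are nonnegative and have total mass one, so the
  one-step mean is a convex combination.\<close>

lemma (in mh_setting) norm_step_mean_le:
  fixes G :: "'e \<Rightarrow> 'e \<Rightarrow> 'a::real_normed_vector"
  assumes "\<And>y x'. norm (G y x') \<le> c"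
  shows "norm (step_mean Q \<rho> G x) \<le> c"
proof -
  have "norm (step_mean Q \<rho> G x) \<le> (\<Sum>y\<in>UNIV. pmf (Q x) y * c)"
    unfolding step_mean_def
  proof (rule sum_norm_le)
    fix y
    have "norm (pmf (Q x) y *\<^sub>R (\<rho> x y *\<^sub>R G y y + (1 - \<rho> x y) *\<^sub>R G y x))
      \<le> norm ((pmf (Q x) y * \<rho> x y) *\<^sub>R G y y) + norm ((pmf (Q x) y * (1 - \<rho> x y)) *\<^sub>R G y x)"
      unfolding scaleR_add_right scaleR_scaleR by (rule norm_triangle_ineq)
    also have "\<dots> = (pmf (Q x) y * \<rho> x y) * norm (G y y) + (pmf (Q x) y * (1 - \<rho> x y)) * norm (G y x)"
      unfolding norm_scaleR by (simp only: abs_of_nonneg accept_weight_nonneg reject_weight_nonneg)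
    also have "\<dots> \<le> (pmf (Q x) y * \<rho> x y) * c + (pmf (Q x) y * (1 - \<rho> x y)) * c"
      by (intro add_mono mult_left_mono assms accept_weight_nonneg reject_weight_nonneg)
    finally show "norm (pmf (Q x) y *\<^sub>R (\<rho> x y *\<^sub>R G y y + (1 - \<rho> x y) *\<^sub>R G y x)) \<le> pmf (Q x) y * c"
      by (simp add: algebra_simps)
  qed
  then show ?thesis by (simp flip: sum_distrib_right)
qed

section \<open>Nonnegativity and optimality of the variance\<close>

lemma (in mh_setting) mh_cv_var_nonneg: "0 \<le> mh_cv_var \<pi> Q \<rho> F \<psi>"
  by (simp add: mh_cv_var_eq mean_nonneg step_mean_nonneg)

text \<open>Both expectations in \<open>mh_cv_var\<close> are nonnegative, and the one that contains
  \<open>\<psi>\<close> vanishes for \<open>\<psi> = F\<close>.\<close>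

lemma (in mh_setting) mh_cv_var_ge: "mh_cv_var \<pi> Q \<rho> F F \<le> mh_cv_var \<pi> Q \<rho> F \<psi>"
  and mh_cv_var_le: "mh_cv_var \<pi> Q \<rho> F F \<le> mh_var \<pi> Q \<rho> F"
proof -
  have nn: "0 \<le> measure_pmf.expectation (mh_first_step \<pi> Q \<rho>)
         (\<lambda>(x0, x1). (1 - \<rho> x0 x1) * (g x1 x0)\<^sup>2)" if "\<And>x. g x x = 0" for g
  proof -
    have "0 \<le> pmf (Q x) y * \<rho> x y * ((1 - \<rho> x y) * (g y x)\<^sup>2)" for x y
      using acceptance_range[of x y]
      by (cases "pmf (Q x) y = 0") (auto simp: order.strict_iff_order)
    then show ?thesis
      using that by (subst expectation_first_step) (auto intro!: mean_nonneg sum_nonneg)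
  qed
  show "mh_cv_var \<pi> Q \<rho> F F \<le> mh_cv_var \<pi> Q \<rho> F \<psi>"
    using nn[of "\<lambda>x1 x0. \<psi> x1 - F x1 - \<psi> x0 + F x0"] by (simp add: mh_cv_var_def case_prod_unfold)
  show "mh_cv_var \<pi> Q \<rho> F F \<le> mh_var \<pi> Q \<rho> F"
    using nn[of "\<lambda>x1 x0. F x1 - F x0"] by (simp add: mh_cv_var_def case_prod_unfold)
qed

subsection \<open>The Markov property\<close>

text \<open>Phrased through level sets so that \<open>T\<close> can be a whole finite history,
  without a sigma-algebra on histories.\<close>

lemma (in prob_space) expectation_finite_range:
  fixes \<phi> :: "'b \<Rightarrow> 'c::{banach, second_countable_topology}"
  assumes S: "finite S" "\<And>\<omega>. \<omega> \<in> space M \<Longrightarrow> T \<omega> \<in> S"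
    and meas: "\<And>s. s \<in> S \<Longrightarrow> {\<omega> \<in> space M. T \<omega> = s} \<in> events"
  shows "(\<integral>\<omega>. \<phi> (T \<omega>) \<partial>M) = (\<Sum>s\<in>S. prob {\<omega> \<in> space M. T \<omega> = s} *\<^sub>R \<phi> s)"
proof -
  have "(\<integral>\<omega>. \<phi> (T \<omega>) \<partial>M) =
    (\<integral>\<omega>. (\<Sum>s\<in>S. indicator {\<omega> \<in> space M. T \<omega> = s} \<omega> *\<^sub>R \<phi> s) \<partial>M)"
  proof (rule Bochner_Integration.integral_cong[OF refl])
    fix \<omega> assume \<omega>: "\<omega> \<in> space M"
    then have "(\<Sum>s\<in>S. indicator {\<omega> \<in> space M. T \<omega> = s} \<omega> *\<^sub>R \<phi> s)
      = (\<Sum>s\<in>S. if T \<omega> = s then \<phi> s else 0)"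
      by (intro sum.cong) (auto simp: indicator_def)
    then show "\<phi> (T \<omega>) = (\<Sum>s\<in>S. indicator {\<omega> \<in> space M. T \<omega> = s} \<omega> *\<^sub>R \<phi> s)"
      using S \<omega> by simp
  qed
  also have "\<dots> = (\<Sum>s\<in>S. prob {\<omega> \<in> space M. T \<omega> = s} *\<^sub>R \<phi> s)"
    using meas
    by (subst Bochner_Integration.integral_sum)
      (auto simp: less_top[symmetric] intro!: sum.cong integrable_scaleR_left)
  finally show ?thesis .
qed

lemma sum_pmf_mh_accept:
  fixes c :: "'e::finite \<Rightarrow> 'a::{banach, second_countable_topology}"
  assumes "0 \<le> \<rho> x y" "\<rho> x y \<le> 1"
  shows "(\<Sum>x'\<in>UNIV. pmf (mh_accept \<rho> x y) x' *\<^sub>R c x') = \<rho> x y *\<^sub>R c y + (1 - \<rho> x y) *\<^sub>R c x"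
proof -
  have "(\<Sum>x'\<in>UNIV. pmf (mh_accept \<rho> x y) x' *\<^sub>R c x') = measure_pmf.expectation (mh_accept \<rho> x y) c"
    by (rule integral_measure_pmf[symmetric]) auto
  also have "\<dots> = measure_pmf.expectation (bernoulli_pmf (\<rho> x y)) (\<lambda>b. c (if b then y else x))"
    by (simp add: mh_accept_def)
  also have "\<dots> = (\<Sum>b\<in>UNIV. pmf (bernoulli_pmf (\<rho> x y)) b *\<^sub>R c (if b then y else x))"
    by (rule integral_measure_pmf) auto
  finally show ?thesis using assms by (simp add: UNIV_bool add.commute)
qed

text \<open>\<open>\<pi>\<close> enters through \<open>mh_setting\<close> alone; the law of
  \<open>X 0\<close> stays arbitrary.\<close>

locale mh_process = mh_setting \<pi> Q \<rho> + mh_chain M Q \<rho> X Xt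
  for \<pi> :: "'e::finite pmf" and Q \<rho> and M :: "'w measure" and X Xt
begin

declare measurable_state [measurable] measurable_proposal [measurable]

lemma measurable_history [measurable]: "Measurable.pred M (mh_history X Xt n x y)"
proof -
  \<comment> \<open>Reindexing by \<open>Suc\<close> exposes the proposals
    \<open>Xt (Suc k)\<close>, whose measurability is assumed.\<close>
  have "mh_history X Xt n x y =
      (\<lambda>\<omega>. (\<forall>k\<in>{..n}. X k \<omega> = x k) \<and> (\<forall>k\<in>{..<n}. Xt (Suc k) \<omega> = y (Suc k)))"
    unfolding mh_history_def image_Suc_lessThan[symmetric]
    by (simp add: fun_eq_iff Ball_def[of "{..n}"] del: image_Suc_lessThan)
  then show ?thesis by simp
qed

text \<open>Chain rule through the proposal and the acceptance. The conditional laws are available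
  only on events of positive probability; on null events both sides vanish.\<close>

lemma prob_history_step:
  "\<P>(\<omega> in M. mh_history X Xt n x y \<omega> \<and> Xt (Suc n) \<omega> = z \<and> X (Suc n) \<omega> = x') =
     \<P>(\<omega> in M. mh_history X Xt n x y \<omega>) * pmf (Q (x n)) z * pmf (mh_accept \<rho> (x n) z) x'"
    (is "prob ?B = prob ?H * _ * _")
proof -
  let ?Z = "{\<omega> \<in> space M. mh_history X Xt n x y \<omega> \<and> Xt (Suc n) \<omega> = z}"
  have Z: "prob ?Z = prob ?H * pmf (Q (x n)) z"
  proof (cases "prob ?H = 0")
    case True
    moreover have "prob ?Z \<le> prob ?H" by (rule finite_measure_mono) auto
    ultimately show ?thesis by (simp add: measure_le_0_iff)
  next
    case False
    then have "0 < prob ?H" by (simp add: zero_less_measure_iff)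
    from proposal_law[OF this, of z] show ?thesis
      using False by (simp add: cond_prob_def field_simps conj_commute)
  qed
  have "prob ?B = prob ?Z * pmf (mh_accept \<rho> (x n) z) x'"
  proof (cases "prob ?Z = 0")
    case True
    moreover have "prob ?B \<le> prob ?Z" by (rule finite_measure_mono) auto
    ultimately show ?thesis by (simp add: measure_le_0_iff)
  next
    case False
    then have "0 < prob ?Z" by (simp add: zero_less_measure_iff)
    from acceptance_law[OF this, of x'] show ?thesis
      using False by (simp add: cond_prob_def field_simps conj_ac)
  qed
  with Z show ?thesis by simp
qed

text \<open>The Markov property, tested against functions \<open>g\<close> of the past. Since
  \<open>E\<close> is finite, both expectations are finite sums over histories, and each history's
  weight factorises.\<close>

lemma expectation_step:
  fixes g :: "(nat \<Rightarrow> 'e) \<Rightarrow> (nat \<Rightarrow> 'e) \<Rightarrow> complex"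
  assumes dep: "\<And>x y x' y'. (\<And>k. k \<le> n \<Longrightarrow> x k = x' k) \<Longrightarrow>
    (\<And>k. k \<in> {1..n} \<Longrightarrow> y k = y' k) \<Longrightarrow> g x y = g x' y'"
  shows "(\<integral>\<omega>. g (\<lambda>k. X k \<omega>) (\<lambda>k. Xt k \<omega>) * G (X n \<omega>) (Xt (Suc n) \<omega>) (X (Suc n) \<omega>) \<partial>M)
    = (\<integral>\<omega>. g (\<lambda>k. X k \<omega>) (\<lambda>k. Xt k \<omega>) * step_mean Q \<rho> (G (X n \<omega>)) (X n \<omega>) \<partial>M)"
proof -
  \<comment> \<open>Extensional functions give every history exactly one representative in a finite
    set; proposals are indexed from 1.\<close>
  define H where "H = (PiE {..n} (\<lambda>_. UNIV :: 'e set)) \<times> (PiE {1..n} (\<lambda>_. UNIV :: 'e set))"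
  define T where "T \<omega> = (restrict (\<lambda>k. X k \<omega>) {..n}, restrict (\<lambda>k. Xt k \<omega>) {1..n})" for \<omega>
  have finH: "finite H" by (auto simp: H_def intro!: finite_PiE)
  have TH: "T \<omega> \<in> H" for \<omega> by (auto simp: T_def H_def)
  have T_iff: "T \<omega> = h \<longleftrightarrow> mh_history X Xt n (fst h) (snd h) \<omega>" if "h \<in> H" for h \<omega>
    using that
    by (auto simp: T_def H_def mh_history_def fun_eq_iff PiE_iff extensional_def restrict_def)
  define gT where "gT h = g (fst h) (snd h)" for h
  have g_T: "g (\<lambda>k. X k \<omega>) (\<lambda>k. Xt k \<omega>) = gT (T \<omega>)" for \<omega>
    unfolding gT_def by (rule dep) (auto simp: T_def)
  have Xn: "X n \<omega> = fst (T \<omega>) n" for \<omega> by (simp add: T_def)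
  let ?p = "\<lambda>h. \<P>(\<omega> in M. mh_history X Xt n (fst h) (snd h) \<omega>)"
  have "(\<integral>\<omega>. g (\<lambda>k. X k \<omega>) (\<lambda>k. Xt k \<omega>) * G (X n \<omega>) (Xt (Suc n) \<omega>) (X (Suc n) \<omega>) \<partial>M)
    = (\<integral>\<omega>. (\<lambda>(h, z, x'). gT h * G (fst h n) z x') (T \<omega>, Xt (Suc n) \<omega>, X (Suc n) \<omega>) \<partial>M)"
    by (simp add: g_T Xn)
  also have "\<dots> = (\<Sum>s\<in>H \<times> UNIV \<times> UNIV. prob {\<omega> \<in> space M. (T \<omega>, Xt (Suc n) \<omega>, X (Suc n) \<omega>) = s}
      *\<^sub>R (\<lambda>(h, z, x'). gT h * G (fst h n) z x') s)"
    by (rule expectation_finite_range) (auto simp: finH TH T_iff)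
  also have "\<dots> = (\<Sum>h\<in>H. \<Sum>z\<in>UNIV. \<Sum>x'\<in>UNIV.
      prob {\<omega> \<in> space M. T \<omega> = h \<and> Xt (Suc n) \<omega> = z \<and> X (Suc n) \<omega> = x'}
      *\<^sub>R (gT h * G (fst h n) z x'))"
    by (simp add: sum.cartesian_product case_prod_unfold prod_eq_iff)
  also have "\<dots> = (\<Sum>h\<in>H. ?p h *\<^sub>R (gT h * step_mean Q \<rho> (G (fst h n)) (fst h n)))"
  proof (rule sum.cong[OF refl])
    fix h assume h: "h \<in> H"
    let ?x = "fst h n"
    have "(\<Sum>z\<in>UNIV. \<Sum>x'\<in>UNIV.
        prob {\<omega> \<in> space M. T \<omega> = h \<and> Xt (Suc n) \<omega> = z \<and> X (Suc n) \<omega> = x'} *\<^sub>R (gT h * G ?x z x'))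
      = (\<Sum>z\<in>UNIV. ?p h *\<^sub>R (gT h * (pmf (Q ?x) z *\<^sub>R
          (\<Sum>x'\<in>UNIV. pmf (mh_accept \<rho> ?x z) x' *\<^sub>R G ?x z x'))))"
      by (simp add: T_iff[OF h] prob_history_step scaleR_sum_right sum_distrib_left mult_ac)
    also have "\<dots> = (\<Sum>z\<in>UNIV. ?p h *\<^sub>R (gT h * (pmf (Q ?x) z *\<^sub>R
          (\<rho> ?x z *\<^sub>R G ?x z z + (1 - \<rho> ?x z) *\<^sub>R G ?x z ?x))))"
    proof (rule sum.cong[OF refl])
      fix z
      show "?p h *\<^sub>R (gT h * (pmf (Q ?x) z *\<^sub>R
          (\<Sum>x'\<in>UNIV. pmf (mh_accept \<rho> ?x z) x' *\<^sub>R G ?x z x')))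
        = ?p h *\<^sub>R (gT h * (pmf (Q ?x) z *\<^sub>R
          (\<rho> ?x z *\<^sub>R G ?x z z + (1 - \<rho> ?x z) *\<^sub>R G ?x z ?x)))"
      proof (cases "pmf (Q ?x) z = 0")
        case False
        then have "0 \<le> \<rho> ?x z" "\<rho> ?x z \<le> 1"
          using acceptance_range[of ?x z] by (auto simp: order.strict_iff_order)
        then show ?thesis by (subst sum_pmf_mh_accept) auto
      qed simp
    qed
    also have "\<dots> = ?p h *\<^sub>R (gT h * step_mean Q \<rho> (G ?x) ?x)"
      by (simp only: step_mean_def scaleR_sum_right sum_distrib_left)
    finally show "(\<Sum>z\<in>UNIV. \<Sum>x'\<in>UNIV.
        prob {\<omega> \<in> space M. T \<omega> = h \<and> Xt (Suc n) \<omega> = z \<and> X (Suc n) \<omega> = x'} *\<^sub>R (gT h * G ?x z x'))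
      = ?p h *\<^sub>R (gT h * step_mean Q \<rho> (G ?x) ?x)" .
  qed
  also have "\<dots> = (\<Sum>h\<in>H. prob {\<omega> \<in> space M. T \<omega> = h} *\<^sub>R
      (gT h * step_mean Q \<rho> (G (fst h n)) (fst h n)))"
    by (rule sum.cong) (simp_all add: T_iff)
  also have "\<dots> = (\<integral>\<omega>. gT (T \<omega>) * step_mean Q \<rho> (G (fst (T \<omega>) n)) (fst (T \<omega>) n) \<partial>M)"
    by (rule expectation_finite_range[symmetric]) (auto simp: finH TH T_iff)
  finally show ?thesis by (simp add: g_T Xn)
qed

definition partial_sum :: "('e \<Rightarrow> 'e \<Rightarrow> 'e \<Rightarrow> real) \<Rightarrow> nat \<Rightarrow> 'w \<Rightarrow> real" where
  "partial_sum D n \<omega> = (\<Sum>k<n. D (X k \<omega>) (Xt (Suc k) \<omega>) (X (Suc k) \<omega>))"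

lemma measurable_partial_sum [measurable]: "partial_sum D n \<in> borel_measurable M"
proof -
  have "(\<lambda>\<omega>. D (X k \<omega>) (Xt (Suc k) \<omega>) (X (Suc k) \<omega>)) \<in> borel_measurable M" for k
    by measurable
  then show ?thesis unfolding partial_sum_def by simp
qed

lemma measurable_fun_state [measurable]: "(\<lambda>\<omega>. h (X n \<omega>)) \<in> borel_measurable M"
  for h :: "'e \<Rightarrow> 'b::topological_space"
  by (rule measurable_compose[OF measurable_state]) simp

end

subsection \<open>Characteristic functions and the central limit theorem\<close>

text \<open>To second order the one-step mean is \<open>1 - u^2 (v + Pw) / 2\<close>, where
  \<open>v\<close> is the conditional variance. The Poisson equation \<open>v + Pw = w + s2\<close>
  turns this into the product of eigenvalue and eigenfunction, up to a term in
  \<open>u^4\<close>.\<close>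

lemma (in mh_setting) char_step_expansion:
  fixes D :: "'e \<Rightarrow> 'e \<Rightarrow> 'e \<Rightarrow> real"
  assumes centred: "\<And>x. step_mean Q \<rho> (D x) x = 0"
    and s2: "s2 = mean \<pi> (\<lambda>x. step_mean Q \<rho> (\<lambda>y x'. (D x y x')\<^sup>2) x)"
    and w: "poisson_solution \<pi> Q \<rho> (\<lambda>x. step_mean Q \<rho> (\<lambda>y x'. (D x y x')\<^sup>2) x) w"
  shows "\<exists>C\<ge>0. \<forall>u x. \<bar>u\<bar> \<le> 1 \<longrightarrow>
    cmod (step_mean Q \<rho> (\<lambda>y x'. iexp (u * D x y x') * complex_of_real (1 - u\<^sup>2 / 2 * w x')) x
      - complex_of_real (1 - u\<^sup>2 * s2 / 2) * complex_of_real (1 - u\<^sup>2 / 2 * w x)) \<le> C * \<bar>u\<bar> ^ 3"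
proof -
  let ?v = "\<lambda>x. step_mean Q \<rho> (\<lambda>y x'. (D x y x')\<^sup>2) x"
  \<comment> \<open>Sums over the finite \<open>E\<close> serve as uniform bounds.\<close>
  define B where "B = (\<Sum>x\<in>UNIV. \<Sum>y\<in>UNIV. \<Sum>x'\<in>UNIV. \<bar>D x y x'\<bar>)"
  define W where "W = (\<Sum>x\<in>UNIV. \<bar>w x\<bar>)"
  have B: "\<bar>D x y x'\<bar> \<le> B" for x y x'
  proof -
    have "\<bar>D x y x'\<bar> \<le> (\<Sum>x'\<in>UNIV. \<bar>D x y x'\<bar>)" by (rule member_le_sum) auto
    also have "\<dots> \<le> (\<Sum>y\<in>UNIV. \<Sum>x'\<in>UNIV. \<bar>D x y x'\<bar>)"
      by (rule member_le_sum[of y UNIV "\<lambda>y. \<Sum>x'\<in>UNIV. \<bar>D x y x'\<bar>"]) (auto intro: sum_nonneg)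
    also have "\<dots> \<le> B" unfolding B_def
      by (rule member_le_sum[of x UNIV "\<lambda>x. \<Sum>y\<in>UNIV. \<Sum>x'\<in>UNIV. \<bar>D x y x'\<bar>"])
        (auto intro!: sum_nonneg)
    finally show ?thesis .
  qed
  have W: "\<bar>w x\<bar> \<le> W" for x unfolding W_def by (rule member_le_sum) auto
  have B0: "0 \<le> B" and W0: "0 \<le> W" by (auto simp: B_def W_def intro!: sum_nonneg)
  have s20: "0 \<le> s2" unfolding s2 by (intro mean_nonneg step_mean_nonneg) simp
  \<comment> \<open>The three terms bound the Taylor remainder, the cross term with
    \<open>w\<close>, and the \<open>u^4\<close> term of the product.\<close>
  define C where "C = B ^ 3 / 6 + W * B / 2 + s2 * W / 4"
  have "cmod (step_mean Q \<rho> (\<lambda>y x'. iexp (u * D x y x') * complex_of_real (1 - u\<^sup>2 / 2 * w x')) x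
      - complex_of_real (1 - u\<^sup>2 * s2 / 2) * complex_of_real (1 - u\<^sup>2 / 2 * w x)) \<le> C * \<bar>u\<bar> ^ 3"
    if u: "\<bar>u\<bar> \<le> 1" for u x
  proof -
    \<comment> \<open>\<open>p\<close> is the expansion to second order in \<open>u\<close>, with
      real part \<open>a\<close>; its linear term averages to zero.\<close>
    define a where "a y x' = 1 + (- u\<^sup>2 / 2) * (D x y x')\<^sup>2 + (- u\<^sup>2 / 2) * w x'" for y x'
    define p where "p y x' = complex_of_real (a y x') + \<i> * complex_of_real (u * D x y x')" for y x'
    define R where
      "R y x' = iexp (u * D x y x') * complex_of_real (1 - u\<^sup>2 / 2 * w x') - p y x'" for y x'
    have R: "cmod (R y x') \<le> (B ^ 3 / 6 + W * B / 2) * \<bar>u\<bar> ^ 3" for y x'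
    proof -
      let ?d = "u * D x y x'"
      have d: "\<bar>?d\<bar> \<le> \<bar>u\<bar> * B" using B by (simp add: abs_mult mult_left_mono)
      have 2: "cmod (iexp ?d - (1 + \<i> * ?d - ?d\<^sup>2 / 2)) \<le> \<bar>?d\<bar> ^ 3 / 6"
        using iexp_approx1[of ?d 2]
        by (simp add: eval_nat_numeral algebra_simps)
      have 0: "cmod (iexp ?d - 1) \<le> \<bar>?d\<bar>"
        using iexp_approx1[of ?d 0] by simp
      \<comment> \<open>In the second summand \<open>iexp ?d - 1\<close> supplies the missing power
        of \<open>u\<close>.\<close>
      have "R y x' = (iexp ?d - (1 + \<i> * ?d - ?d\<^sup>2 / 2))
          - complex_of_real (u\<^sup>2 / 2 * w x') * (iexp ?d - 1)"
        by (simp add: R_def p_def a_def field_simps power_mult_distrib)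
      then have "cmod (R y x') \<le> cmod (iexp ?d - (1 + \<i> * ?d - ?d\<^sup>2 / 2))
          + cmod (complex_of_real (u\<^sup>2 / 2 * w x') * (iexp ?d - 1))"
        using norm_triangle_ineq4 by metis
      also have "\<dots> \<le> \<bar>?d\<bar> ^ 3 / 6 + \<bar>u\<^sup>2 / 2 * w x'\<bar> * \<bar>?d\<bar>"
        unfolding norm_mult norm_of_real by (intro add_mono 2 mult_left_mono 0) auto
      also have "\<dots> \<le> (\<bar>u\<bar> * B) ^ 3 / 6 + (u\<^sup>2 / 2 * W) * (\<bar>u\<bar> * B)"
        using W[of x'] d B0 W0
        by (intro add_mono divide_right_mono power_mono mult_mono) (auto simp: abs_mult mult_left_mono)
      also have "\<dots> = (B ^ 3 / 6 + W * B / 2) * \<bar>u\<bar> ^ 3"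
      proof -
        have "(s * B) ^ 3 / 6 + (s\<^sup>2 / 2 * W) * (s * B) = (B ^ 3 / 6 + W * B / 2) * s ^ 3" for s
          by (simp add: power3_eq_cube power2_eq_square algebra_simps)
        from this[of "\<bar>u\<bar>"] show ?thesis by (simp only: power2_abs)
      qed
      finally show ?thesis .
    qed
    have P: "mh_op Q \<rho> w x = w x - ?v x + s2"
      using w[unfolded poisson_solution_def, rule_format, of x] by (simp add: s2)
    have "step_mean Q \<rho> a x = 1 + (- u\<^sup>2 / 2) * ?v x + (- u\<^sup>2 / 2) * mh_op Q \<rho> w x"
      unfolding a_def[abs_def] step_mean_add step_mean_const mh_op_eq_step_mean
        step_mean_linear[OF linear_times[of "- u\<^sup>2 / 2"]] ..
    also have "\<dots> = 1 - u\<^sup>2 / 2 * (w x + s2)"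
      by (simp add: P field_simps)
    finally have a: "step_mean Q \<rho> a x = 1 - u\<^sup>2 / 2 * (w x + s2)" .
    have lin1: "linear complex_of_real" and lin2: "linear (\<lambda>r. \<i> * complex_of_real (u * r))"
      by (auto intro!: linearI simp: scaleR_conv_of_real algebra_simps)
    have p: "step_mean Q \<rho> p x = complex_of_real (1 - u\<^sup>2 / 2 * (w x + s2))"
      unfolding p_def[abs_def] step_mean_add step_mean_linear[OF lin1] step_mean_linear[OF lin2] a
      by (simp add: centred)
    have "step_mean Q \<rho> (\<lambda>y x'. iexp (u * D x y x') * complex_of_real (1 - u\<^sup>2 / 2 * w x')) x
      = step_mean Q \<rho> (\<lambda>y x'. p y x' + R y x') x"
      by (simp add: R_def)
    also have "\<dots> - complex_of_real (1 - u\<^sup>2 * s2 / 2) * complex_of_real (1 - u\<^sup>2 / 2 * w x)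
      = step_mean Q \<rho> R x - complex_of_real (u ^ 4 * s2 * w x / 4)"
      unfolding step_mean_add p by (simp add: field_simps power2_eq_square power4_eq_xxxx)
    also have "cmod \<dots> \<le> (B ^ 3 / 6 + W * B / 2) * \<bar>u\<bar> ^ 3 + s2 * W / 4 * \<bar>u\<bar> ^ 3"
    proof (rule order_trans[OF norm_triangle_ineq4 add_mono])
      show "cmod (step_mean Q \<rho> R x) \<le> (B ^ 3 / 6 + W * B / 2) * \<bar>u\<bar> ^ 3"
        by (rule norm_step_mean_le) (rule R)
      \<comment> \<open>The bound \<open>\<bar>u\<bar> \<le> 1\<close> lowers the fourth power to
        the third.\<close>
      have "\<bar>u\<bar> ^ 4 * (s2 * \<bar>w x\<bar>) \<le> \<bar>u\<bar> ^ 3 * (s2 * W)"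
        using u W[of x] s20 by (intro mult_mono power_decreasing mult_nonneg_nonneg) auto
      then show "cmod (complex_of_real (u ^ 4 * s2 * w x / 4)) \<le> s2 * W / 4 * \<bar>u\<bar> ^ 3"
        using s20 unfolding norm_of_real by (simp add: abs_mult power_abs algebra_simps)
    qed
    finally show ?thesis by (simp add: C_def algebra_simps)
  qed
  moreover have "0 \<le> C" using B0 W0 s20 by (simp add: C_def)
  ultimately show ?thesis by blast
qed

context mh_process
begin

lemma integrable_bounded_complex:
  fixes Z :: "'w \<Rightarrow> complex"
  assumes "Z \<in> borel_measurable M" "\<And>\<omega>. cmod (Z \<omega>) \<le> c"
  shows "integrable M Z"
  using assms by (intro integrable_const_bound[of _ c]) auto

lemma norm_expectation_le:
  fixes Z :: "'w \<Rightarrow> complex"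
  assumes "Z \<in> borel_measurable M" "\<And>\<omega>. cmod (Z \<omega>) \<le> c"
  shows "cmod (\<integral>\<omega>. Z \<omega> \<partial>M) \<le> c"
proof -
  have "cmod (\<integral>\<omega>. Z \<omega> \<partial>M) \<le> (\<integral>\<omega>. cmod (Z \<omega>) \<partial>M)"
    by (rule integral_norm_bound)
  also have "\<dots> \<le> (\<integral>\<omega>. c \<partial>M)"
    using assms by (intro integral_mono integrable_norm integrable_bounded_complex) auto
  finally show ?thesis by (simp add: prob_space)
qed

text \<open>Weighting by the approximate eigenfunction gives
  \<open>a (Suc k) = l * a k + O(u^3)\<close>. Iterating costs \<open>n\<close> such errors, and
  replacing the weight by 1 costs \<open>O(u^2)\<close> at each end, whatever the initial
  law.\<close>

lemma char_partial_sum: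
  assumes centred: "\<And>x. step_mean Q \<rho> (D x) x = 0"
    and s2: "s2 = mean \<pi> (\<lambda>x. step_mean Q \<rho> (\<lambda>y x'. (D x y x')\<^sup>2) x)"
  shows "\<exists>C\<ge>0. \<forall>u n. \<bar>u\<bar> \<le> 1 \<longrightarrow> u\<^sup>2 * s2 \<le> 4 \<longrightarrow>
    cmod ((\<integral>\<omega>. iexp (u * partial_sum D n \<omega>) \<partial>M) - complex_of_real (1 - u\<^sup>2 * s2 / 2) ^ n)
      \<le> C * (u\<^sup>2 + real n * \<bar>u\<bar> ^ 3)"
proof -
  obtain w where w: "poisson_solution \<pi> Q \<rho> (\<lambda>x. step_mean Q \<rho> (\<lambda>y x'. (D x y x')\<^sup>2) x) w"
    using poisson_solvable by blast
  obtain C where C0: "0 \<le> C" and C: "\<And>u x. \<bar>u\<bar> \<le> 1 \<Longrightarrow>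
    cmod (step_mean Q \<rho> (\<lambda>y x'. iexp (u * D x y x') * complex_of_real (1 - u\<^sup>2 / 2 * w x')) x
      - complex_of_real (1 - u\<^sup>2 * s2 / 2) * complex_of_real (1 - u\<^sup>2 / 2 * w x)) \<le> C * \<bar>u\<bar> ^ 3"
    using char_step_expansion[OF centred s2 w] by blast
  define W where "W = (\<Sum>x\<in>UNIV. \<bar>w x\<bar>)"
  have W: "\<bar>w x\<bar> \<le> W" for x unfolding W_def by (rule member_le_sum) auto
  have W0: "0 \<le> W" by (auto simp: W_def intro!: sum_nonneg)
  have s20: "0 \<le> s2" unfolding s2 by (intro mean_nonneg step_mean_nonneg) simp
  have "cmod ((\<integral>\<omega>. iexp (u * partial_sum D n \<omega>) \<partial>M) - complex_of_real (1 - u\<^sup>2 * s2 / 2) ^ n)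
      \<le> (W + C) * (u\<^sup>2 + real n * \<bar>u\<bar> ^ 3)" if u: "\<bar>u\<bar> \<le> 1" and u4: "u\<^sup>2 * s2 \<le> 4" for u n
  proof -
    define l where "l = complex_of_real (1 - u\<^sup>2 * s2 / 2)"
    define h where "h x = complex_of_real (1 - u\<^sup>2 / 2 * w x)" for x
    define e where "e k \<omega> = iexp (u * partial_sum D k \<omega>)" for k \<omega>
    define a where "a k = (\<integral>\<omega>. e k \<omega> * h (X k \<omega>) \<partial>M)" for k
    \<comment> \<open>The condition \<open>u^2 * s2 \<le> 4\<close> keeps the eigenvalue in
      [-1,1].\<close>
    have l1: "cmod l \<le> 1"
      using u4 s20 unfolding l_def norm_of_real by (simp add: abs_le_iff)
    have h1: "cmod (h x - 1) \<le> u\<^sup>2 / 2 * W" for x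
    proof -
      have "h x - 1 = complex_of_real (- (u\<^sup>2 / 2 * w x))" by (simp add: h_def)
      then have "cmod (h x - 1) = \<bar>u\<^sup>2 / 2 * w x\<bar>"
        by (simp only: norm_of_real abs_minus_cancel)
      also have "\<dots> \<le> u\<^sup>2 / 2 * W"
        using W[of x] unfolding abs_mult by (simp add: mult_left_mono)
      finally show ?thesis .
    qed
    have e_meas [measurable]: "e k \<in> borel_measurable M" for k
      unfolding e_def[abs_def] by measurable
    have e1: "cmod (e k \<omega>) = 1" for k \<omega> by (simp add: e_def)
    have int_e: "integrable M (e k)" for k by (rule integrable_bounded_complex[of _ 1]) (auto simp: e1)
    have int_eh: "integrable M (\<lambda>\<omega>. e k \<omega> * q (X k \<omega>))" for k and q :: "'e \<Rightarrow> complex"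
    proof (rule integrable_bounded_complex)
      show "cmod (e k \<omega> * q (X k \<omega>)) \<le> (\<Sum>x\<in>UNIV. cmod (q x))" for \<omega>
        unfolding norm_mult e1 mult_1 by (rule member_le_sum) auto
    qed simp
    have step: "cmod (a (Suc k) - l * a k) \<le> C * \<bar>u\<bar> ^ 3" for k
    proof -
      let ?G = "\<lambda>x y x'. iexp (u * D x y x') * h x'"
      have "a (Suc k) = (\<integral>\<omega>. e k \<omega> * ?G (X k \<omega>) (Xt (Suc k) \<omega>) (X (Suc k) \<omega>) \<partial>M)"
        by (simp add: a_def e_def partial_sum_def distrib_left exp_add mult.assoc)
      \<comment> \<open>The past factor, written as a function of the paths, reads states before
        time \<open>k\<close> and proposals 1 to \<open>k\<close>, as
        \<open>expectation_step\<close> allows.\<close>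
      also have "\<dots> = (\<integral>\<omega>. (\<lambda>x y. iexp (u * (\<Sum>j<k. D (x j) (y (Suc j)) (x (Suc j)))))
          (\<lambda>k. X k \<omega>) (\<lambda>k. Xt k \<omega>) * ?G (X k \<omega>) (Xt (Suc k) \<omega>) (X (Suc k) \<omega>) \<partial>M)"
        by (simp add: e_def partial_sum_def)
      also have "\<dots> = (\<integral>\<omega>. (\<lambda>x y. iexp (u * (\<Sum>j<k. D (x j) (y (Suc j)) (x (Suc j)))))
          (\<lambda>k. X k \<omega>) (\<lambda>k. Xt k \<omega>) * step_mean Q \<rho> (?G (X k \<omega>)) (X k \<omega>) \<partial>M)"
        by (rule expectation_step) (auto intro!: arg_cong[where f = iexp] sum.cong)
      also have "\<dots> = (\<integral>\<omega>. e k \<omega> * step_mean Q \<rho> (?G (X k \<omega>)) (X k \<omega>) \<partial>M)"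
        by (simp add: e_def partial_sum_def)
      finally have "a (Suc k) - l * a k =
        (\<integral>\<omega>. e k \<omega> * step_mean Q \<rho> (?G (X k \<omega>)) (X k \<omega>) \<partial>M) - (\<integral>\<omega>. e k \<omega> * (l * h (X k \<omega>)) \<partial>M)"
        by (simp add: a_def mult.left_commute)
      also have "\<dots> = (\<integral>\<omega>. e k \<omega> * step_mean Q \<rho> (?G (X k \<omega>)) (X k \<omega>) - e k \<omega> * (l * h (X k \<omega>)) \<partial>M)"
        using int_eh[of k "\<lambda>x. step_mean Q \<rho> (?G x) x"] int_eh[of k "\<lambda>x. l * h x"]
        by (rule Bochner_Integration.integral_diff[symmetric])
      also have "cmod \<dots> \<le> C * \<bar>u\<bar> ^ 3"
      proof (rule norm_expectation_le)
        show "cmod (e k \<omega> * step_mean Q \<rho> (?G (X k \<omega>)) (X k \<omega>) - e k \<omega> * (l * h (X k \<omega>)))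
          \<le> C * \<bar>u\<bar> ^ 3" for \<omega>
          using C[OF u, of "X k \<omega>"]
          by (simp only: right_diff_distrib[symmetric] norm_mult e1 l_def h_def mult_1)
      qed (use borel_measurable_integrable[OF int_eh[of k "\<lambda>x. step_mean Q \<rho> (?G x) x"]]
          borel_measurable_integrable[OF int_eh[of k "\<lambda>x. l * h x"]] in measurable)
      finally show ?thesis .
    qed
    \<comment> \<open>Since \<open>cmod l \<le> 1\<close>, earlier errors are never amplified and
      add up linearly.\<close>
    have geo: "cmod (a k - l ^ k * a 0) \<le> real k * (C * \<bar>u\<bar> ^ 3)" for k
    proof (induction k)
      case (Suc k)
      have "a (Suc k) - l ^ Suc k * a 0 = (a (Suc k) - l * a k) + l * (a k - l ^ k * a 0)"
        by (simp add: algebra_simps)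
      also have "cmod \<dots> \<le> C * \<bar>u\<bar> ^ 3 + 1 * (real k * (C * \<bar>u\<bar> ^ 3))"
      proof (rule norm_triangle_mono[OF step])
        show "cmod (l * (a k - l ^ k * a 0)) \<le> 1 * (real k * (C * \<bar>u\<bar> ^ 3))"
          unfolding norm_mult[of l] by (rule mult_mono[OF l1 Suc.IH]) auto
      qed
      finally show ?case by (simp add: algebra_simps)
    qed simp
    have close: "cmod (a k - (\<integral>\<omega>. e k \<omega> \<partial>M)) \<le> u\<^sup>2 / 2 * W" for k
    proof -
      have "a k - (\<integral>\<omega>. e k \<omega> \<partial>M) = (\<integral>\<omega>. e k \<omega> * h (X k \<omega>) - e k \<omega> \<partial>M)"
        unfolding a_def by (rule Bochner_Integration.integral_diff[symmetric, OF int_eh int_e])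
      also have "cmod \<dots> \<le> u\<^sup>2 / 2 * W"
      proof (rule norm_expectation_le)
        show "cmod (e k \<omega> * h (X k \<omega>) - e k \<omega>) \<le> u\<^sup>2 / 2 * W" for \<omega>
        proof -
          have "e k \<omega> * h (X k \<omega>) - e k \<omega> = e k \<omega> * (h (X k \<omega>) - 1)" by (simp add: algebra_simps)
          then show ?thesis using h1[of "X k \<omega>"] by (simp only: norm_mult e1 mult_1)
        qed
      qed measurable
      finally show ?thesis .
    qed
    have a0: "cmod (a 0 - 1) \<le> u\<^sup>2 / 2 * W"
      using close[of 0] by (simp add: e_def partial_sum_def prob_space)
    have "(\<integral>\<omega>. e n \<omega> \<partial>M) - l ^ n
      = l ^ n * (a 0 - 1) + (a n - l ^ n * a 0) - (a n - (\<integral>\<omega>. e n \<omega> \<partial>M))"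
      by (simp add: algebra_simps)
    also have "cmod \<dots> \<le> cmod (l ^ n * (a 0 - 1)) + cmod (a n - l ^ n * a 0)
        + cmod (a n - (\<integral>\<omega>. e n \<omega> \<partial>M))"
      by (intro order_trans[OF norm_triangle_ineq4] add_mono norm_triangle_ineq order_refl)
    also have "\<dots> \<le> u\<^sup>2 / 2 * W + real n * (C * \<bar>u\<bar> ^ 3) + u\<^sup>2 / 2 * W"
    proof (intro add_mono geo close)
      have "cmod (l ^ n) \<le> 1" using l1 by (simp add: norm_power power_le_one)
      then have "cmod (l ^ n) * cmod (a 0 - 1) \<le> 1 * (u\<^sup>2 / 2 * W)"
        by (rule mult_mono[OF _ a0]) auto
      then show "cmod (l ^ n * (a 0 - 1)) \<le> u\<^sup>2 / 2 * W" by (simp add: norm_mult)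
    qed
    also have "\<dots> \<le> (W + C) * (u\<^sup>2 + real n * \<bar>u\<bar> ^ 3)"
      using W0 C0 by (simp add: algebra_simps)
    finally show ?thesis by (simp add: e_def l_def)
  qed
  with W0 C0 show ?thesis by (intro exI[of _ "W + C"]) auto
qed

end

section \<open>Gaussian laws, including the degenerate one\<close>

lemma real_distribution_gaussian: "0 \<le> v \<Longrightarrow> real_distribution (gaussian m v)"
  unfolding gaussian_def real_distribution_def real_distribution_axioms_def
  by (auto intro: prob_space_return prob_space_normal_density)

text \<open>A point mass at 0 has characteristic function 1; otherwise dividing by the standard
  deviation reduces to the standard normal law at \<open>t * \<sigma>\<close>.\<close>

lemma char_gaussian:
  assumes "0 \<le> v"
  shows "char (gaussian 0 v) t = complex_of_real (exp (- (v * t\<^sup>2) / 2))"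
proof (cases "v = 0")
  case True
  then show ?thesis by (simp add: gaussian_def char_def integral_return)
next
  case False
  define \<sigma> where "\<sigma> = sqrt v"
  have \<sigma>: "0 < \<sigma>" "\<sigma>\<^sup>2 = v" using False assms by (auto simp: \<sigma>_def)
  let ?N = "density lborel (\<lambda>x. ennreal (normal_density 0 \<sigma> x))"
  interpret N: prob_space ?N using \<sigma>(1) by (rule prob_space_normal_density)
  have "distributed ?N lborel (\<lambda>x. x) (normal_density 0 \<sigma>)"
    by (auto simp: distributed_def distr_id2 sets_density)
  then have "distributed ?N lborel (\<lambda>x. (x - 0) / \<sigma>) std_normal_density"
    using N.normal_standard_normal_convert[OF \<sigma>(1), of "\<lambda>x. x" 0] by blast
  then have std: "distr ?N lborel (\<lambda>x. x / \<sigma>) = std_normal_distribution"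
    by (simp add: distributed_def)
  have "char std_normal_distribution (t * \<sigma>) = (\<integral>x. iexp (t * \<sigma> * (x / \<sigma>)) \<partial>?N)"
    unfolding char_def std[symmetric] by (rule integral_distr) simp_all
  also have "\<dots> = char (gaussian 0 v) t"
    using \<sigma> False by (simp add: gaussian_def char_def flip: \<sigma>_def)
  finally show ?thesis
    using \<sigma> by (simp add: char_std_normal_distribution power_mult_distrib mult.commute)
qed

section \<open>Passage to the limit\<close>

context mh_process
begin

text \<open>With \<open>u = t / sqrt n\<close> the error is of order
  \<open>t^2 / n + \<bar>t\<bar>^3 / sqrt n\<close>, and the power of the eigenvalue is the
  classical sequence converging to the exponential.\<close>

lemma char_partial_sum_tendsto:
  assumes centred: "\<And>x. step_mean Q \<rho> (D x) x = 0"
    and s2: "s2 = mean \<pi> (\<lambda>x. step_mean Q \<rho> (\<lambda>y x'. (D x y x')\<^sup>2) x)"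
  shows "(\<lambda>n. \<integral>\<omega>. iexp (t / sqrt (real n) * partial_sum D n \<omega>) \<partial>M)
    \<longlonglongrightarrow> complex_of_real (exp (- (s2 * t\<^sup>2) / 2))"
proof -
  obtain C where C: "\<And>u n. \<bar>u\<bar> \<le> 1 \<Longrightarrow> u\<^sup>2 * s2 \<le> 4 \<Longrightarrow>
    cmod ((\<integral>\<omega>. iexp (u * partial_sum D n \<omega>) \<partial>M) - complex_of_real (1 - u\<^sup>2 * s2 / 2) ^ n)
      \<le> C * (u\<^sup>2 + real n * \<bar>u\<bar> ^ 3)"
    using char_partial_sum[OF centred s2] by blast
  let ?u = "\<lambda>n. t / sqrt (real n)"
  have u0: "?u \<longlonglongrightarrow> 0" by real_asymp
  have "(\<lambda>n. (?u n)\<^sup>2 * s2) \<longlonglongrightarrow> 0\<^sup>2 * s2"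
    by (intro tendsto_intros u0)
  then have u2: "(\<lambda>n. (?u n)\<^sup>2 * s2) \<longlonglongrightarrow> 0" by simp
  have "\<forall>\<^sub>F n in sequentially. \<bar>?u n\<bar> < 1" "\<forall>\<^sub>F n in sequentially. (?u n)\<^sup>2 * s2 < 4"
    using order_tendstoD(2)[OF tendsto_rabs_zero[OF u0], of 1] order_tendstoD(2)[OF u2, of 4]
    by simp_all
  then have bound: "\<forall>\<^sub>F n in sequentially.
    cmod ((\<integral>\<omega>. iexp (?u n * partial_sum D n \<omega>) \<partial>M) - complex_of_real (1 - (?u n)\<^sup>2 * s2 / 2) ^ n)
      \<le> C * ((?u n)\<^sup>2 + real n * \<bar>?u n\<bar> ^ 3)"
    by eventually_elim (rule C; simp)
  have err: "(\<lambda>n. C * ((?u n)\<^sup>2 + real n * \<bar>?u n\<bar> ^ 3)) \<longlonglongrightarrow> 0"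
  proof -
    have "(\<lambda>n. a / real n) \<longlonglongrightarrow> 0" "(\<lambda>n. a / sqrt (real n)) \<longlonglongrightarrow> 0" for a
      by real_asymp+
    then have "(\<lambda>n. C * (t\<^sup>2 / real n + \<bar>t\<bar> ^ 3 / sqrt (real n))) \<longlonglongrightarrow> C * (0 + 0)"
      by (intro tendsto_intros)
    then have "(\<lambda>n. C * (t\<^sup>2 / real n + \<bar>t\<bar> ^ 3 / sqrt (real n))) \<longlonglongrightarrow> 0" by simp
    moreover have "\<forall>\<^sub>F n in sequentially. C * (t\<^sup>2 / real n + \<bar>t\<bar> ^ 3 / sqrt (real n))
      = C * ((?u n)\<^sup>2 + real n * \<bar>?u n\<bar> ^ 3)"
      using eventually_gt_at_top[of 0]
    proof eventually_elim
      case (elim n)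
      define s where "s = sqrt (real n)"
      have "real n = s * s" "0 < s" using elim by (simp_all add: s_def)
      then show ?case
        unfolding s_def[symmetric]
        by (simp add: abs_divide power_divide power2_eq_square power3_eq_cube field_simps)
    qed
    ultimately show ?thesis by (rule Lim_transform_eventually)
  qed
  have "(\<lambda>n. (\<integral>\<omega>. iexp (?u n * partial_sum D n \<omega>) \<partial>M) - complex_of_real (1 - (?u n)\<^sup>2 * s2 / 2) ^ n)
    \<longlonglongrightarrow> 0"
    by (rule Lim_null_comparison[OF bound err])
  moreover have "(\<lambda>n. complex_of_real (1 - (?u n)\<^sup>2 * s2 / 2) ^ n)
    \<longlonglongrightarrow> complex_of_real (exp (- (s2 * t\<^sup>2) / 2))"
  proof -
    have "(\<lambda>n. complex_of_real ((1 + (- (s2 * t\<^sup>2) / 2) / real n) ^ n))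
      \<longlonglongrightarrow> complex_of_real (exp (- (s2 * t\<^sup>2) / 2))"
      by (intro tendsto_of_real tendsto_exp_limit_sequentially)
    then show ?thesis by (simp add: power_divide mult.commute)
  qed
  ultimately show ?thesis using tendsto_add by fastforce
qed

text \<open>The Poisson equation replaces \<open>f\<close> by \<open>F - PF\<close> plus its mean;
  pairing \<open>F(X (k+1))\<close> with \<open>PF(X k)\<close> leaves a telescoping sum.\<close>

lemma sqrt_error_eq:
  assumes F: "poisson_solution \<pi> Q \<rho> f F" and n: "0 < n"
  shows "sqrt (real n) * (mh_I_cv \<rho> X Xt f \<psi> n \<omega> - mean \<pi> f) =
    partial_sum (mh_increment Q \<rho> F \<psi>) n \<omega> / sqrt (real n)
      + (mh_op Q \<rho> F (X 0 \<omega>) - mh_op Q \<rho> F (X n \<omega>)) / sqrt (real n)"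
proof -
  let ?P = "mh_op Q \<rho> F"
  let ?J = "\<Sum>k<n. \<rho> (X k \<omega>) (Xt (Suc k) \<omega>) * \<psi> (Xt (Suc k) \<omega>)
      + (1 - \<rho> (X k \<omega>) (Xt (Suc k) \<omega>)) * \<psi> (X k \<omega>) - \<psi> (X (Suc k) \<omega>)"
  have f: "f x = F x - ?P x + mean \<pi> f" for x
    using F[unfolded poisson_solution_def, rule_format, of x] by simp
  have "(\<Sum>k=1..n. f (X k \<omega>)) = (\<Sum>k<n. f (X (Suc k) \<omega>))"
    by (simp add: sum.shift_bounds_Suc_ivl sum.atLeast1_atMost_eq)
  also have "\<dots> = (\<Sum>k<n. F (X (Suc k) \<omega>) - ?P (X (Suc k) \<omega>)) + real n * mean \<pi> f"
    by (subst f) (simp add: sum.distrib)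
  also have "(\<Sum>k<n. F (X (Suc k) \<omega>) - ?P (X (Suc k) \<omega>)) =
    (\<Sum>k<n. F (X (Suc k) \<omega>) - ?P (X k \<omega>)) - (\<Sum>k<n. ?P (X (Suc k) \<omega>) - ?P (X k \<omega>))"
    by (simp flip: sum_subtractf)
  also have "(\<Sum>k<n. ?P (X (Suc k) \<omega>) - ?P (X k \<omega>)) = ?P (X n \<omega>) - ?P (X 0 \<omega>)"
    by (rule sum_lessThan_telescope)
  finally have "(\<Sum>k=1..n. f (X k \<omega>)) + ?J - real n * mean \<pi> f
    = partial_sum (mh_increment Q \<rho> F \<psi>) n \<omega> + (?P (X 0 \<omega>) - ?P (X n \<omega>))"
    by (simp add: partial_sum_def mh_increment_def sum.distrib sum_subtractf)
  moreover have "sqrt (real n) * (a / real n + b / real n - m) = (a + b - real n * m) / sqrt (real n)"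
    for a b m
  proof -
    define s where "s = sqrt (real n)"
    have "real n = s * s" "s \<noteq> 0" using n by (simp_all add: s_def)
    then show ?thesis unfolding s_def[symmetric] by (simp add: field_simps)
  qed
  then have "sqrt (real n) * (mh_I_cv \<rho> X Xt f \<psi> n \<omega> - mean \<pi> f)
    = ((\<Sum>k=1..n. f (X k \<omega>)) + ?J - real n * mean \<pi> f) / sqrt (real n)"
    unfolding mh_I_cv_def mh_I_def mh_J_def .
  ultimately show ?thesis by (simp add: add_divide_distrib)
qed

text \<open>By Levy continuity it suffices to compare characteristic functions; the boundary term
  \<open>PF(X 0) - PF(X n)\<close> is bounded and vanishes after division by
  \<open>sqrt n\<close>.\<close>

lemma clt:
  assumes F: "poisson_solution \<pi> Q \<rho> f F"
  shows "weak_conv_m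
     (\<lambda>n. distr M borel (\<lambda>\<omega>. sqrt (real n) * (mh_I_cv \<rho> X Xt f \<psi> n \<omega> - mean \<pi> f)))
     (gaussian 0 (mh_cv_var \<pi> Q \<rho> F \<psi>))"
proof -
  define S where "S n \<omega> = sqrt (real n) * (mh_I_cv \<rho> X Xt f \<psi> n \<omega> - mean \<pi> f)" for n \<omega>
  let ?D = "mh_increment Q \<rho> F \<psi>"
  let ?P = "mh_op Q \<rho> F"
  have S_meas [measurable]: "S n \<in> borel_measurable M" for n
  \<comment> \<open>For \<open>n = 0\<close> the factor \<open>sqrt 0\<close> makes
    \<open>S 0\<close> the zero function.\<close>
  proof (cases "n = 0")
    case False
    then have "S n = (\<lambda>\<omega>. partial_sum ?D n \<omega> / sqrt (real n)
        + (?P (X 0 \<omega>) - ?P (X n \<omega>)) / sqrt (real n))"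
      by (auto simp: S_def sqrt_error_eq[OF F])
    then show ?thesis by simp
  qed (simp add: S_def[abs_def])
  have "(\<lambda>n. char (distr M borel (S n)) t) \<longlonglongrightarrow> char (gaussian 0 (mh_cv_var \<pi> Q \<rho> F \<psi>)) t" for t
  proof -
  define B where "B = (\<Sum>x\<in>UNIV. \<bar>?P x\<bar>)"
  have B: "\<bar>?P x\<bar> \<le> B" for x unfolding B_def by (rule member_le_sum) auto
  let ?E = "\<lambda>n. \<integral>\<omega>. iexp (t / sqrt (real n) * partial_sum ?D n \<omega>) \<partial>M"
  have "\<forall>\<^sub>F n in sequentially. cmod (char (distr M borel (S n)) t - ?E n)
    \<le> \<bar>t\<bar> * (2 * B) / sqrt (real n)"
    using eventually_gt_at_top[of 0]
  proof eventually_elim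
    case (elim n)
    have "char (distr M borel (S n)) t - ?E n
      = (\<integral>\<omega>. iexp (t * S n \<omega>) - iexp (t / sqrt (real n) * partial_sum ?D n \<omega>) \<partial>M)"
      unfolding char_def
      by (subst integral_distr)
        (auto intro!: Bochner_Integration.integral_diff[symmetric] integrable_bounded_complex[of _ 1])
    also have "cmod \<dots> \<le> \<bar>t\<bar> * (2 * B) / sqrt (real n)"
    proof (rule norm_expectation_le)
      fix \<omega>
      define r where "r = t * ((?P (X 0 \<omega>) - ?P (X n \<omega>)) / sqrt (real n))"
      have "t * S n \<omega> = t / sqrt (real n) * partial_sum ?D n \<omega> + r"
        unfolding S_def sqrt_error_eq[OF F elim] r_def by (simp add: algebra_simps)
      \<comment> \<open>Factoring out a number of modulus one leaves \<open>iexp r - 1\<close>, of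
        modulus at most \<open>\<bar>r\<bar>\<close>.\<close>
      then have "iexp (t * S n \<omega>) - iexp (t / sqrt (real n) * partial_sum ?D n \<omega>)
        = iexp (t / sqrt (real n) * partial_sum ?D n \<omega>) * (iexp r - 1)"
        by (simp only: of_real_add distrib_left exp_add right_diff_distrib mult_1_right)
      then have "cmod (iexp (t * S n \<omega>) - iexp (t / sqrt (real n) * partial_sum ?D n \<omega>))
        = cmod (iexp r - 1)"
        by (simp only: norm_mult norm_exp_i_times mult_1)
      also have "\<dots> \<le> \<bar>r\<bar>" using iexp_approx1[of r 0] by simp
      also have "\<dots> \<le> \<bar>t\<bar> * ((2 * B) / sqrt (real n))"
        unfolding r_def abs_mult abs_divide
        using B[of "X 0 \<omega>"] B[of "X n \<omega>"] by (auto intro!: mult_left_mono divide_right_mono)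
      finally show "cmod (iexp (t * S n \<omega>) - iexp (t / sqrt (real n) * partial_sum ?D n \<omega>))
        \<le> \<bar>t\<bar> * (2 * B) / sqrt (real n)" by simp
    qed measurable
    finally show ?case .
  qed
  moreover have "(\<lambda>n. \<bar>t\<bar> * (2 * B) / sqrt (real n)) \<longlonglongrightarrow> 0" by real_asymp
  ultimately have "(\<lambda>n. char (distr M borel (S n)) t - ?E n) \<longlonglongrightarrow> 0"
    by (rule Lim_null_comparison)
  moreover have "?E \<longlonglongrightarrow> char (gaussian 0 (mh_cv_var \<pi> Q \<rho> F \<psi>)) t"
    unfolding char_gaussian[OF mh_cv_var_nonneg]
    by (rule char_partial_sum_tendsto[OF step_mean_increment mh_cv_var_eq])
  ultimately show ?thesis
    using tendsto_add by fastforce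
  qed
  then have "weak_conv_m (\<lambda>n. distr M borel (S n)) (gaussian 0 (mh_cv_var \<pi> Q \<rho> F \<psi>))"
    by (intro levy_continuity real_distribution_distr real_distribution_gaussian
      mh_cv_var_nonneg S_meas)
  then show ?thesis by (simp only: S_def[abs_def])
qed

end

text \<open>Existence of \<open>F\<close> keeps the quantification over Poisson solutions from being
  vacuous; nonnegativity of the variance makes \<open>gaussian\<close> a genuine law.\<close>

theorem proposition2p2:
  fixes \<pi> :: "'e::finite pmf"
    and Q :: "'e \<Rightarrow> 'e pmf"
    and \<rho> :: "'e \<Rightarrow> 'e \<Rightarrow> real"
    and M :: "'w measure"
    and X Xt :: "nat \<Rightarrow> 'w \<Rightarrow> 'e"
    and f :: "'e \<Rightarrow> real"
  assumes "mh_setting \<pi> Q \<rho>"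
    and "mh_chain M Q \<rho> X Xt"
  shows "(\<exists>F. poisson_solution \<pi> Q \<rho> f F) \<and>
    (\<forall>F. poisson_solution \<pi> Q \<rho> f F \<longrightarrow>
      (\<forall>\<psi> :: 'e \<Rightarrow> real.
         0 \<le> mh_cv_var \<pi> Q \<rho> F \<psi> \<and>
         weak_conv_m
           (\<lambda>n. distr M borel (\<lambda>\<omega>. sqrt (real n) * (mh_I_cv \<rho> X Xt f \<psi> n \<omega> - mean \<pi> f)))
           (gaussian 0 (mh_cv_var \<pi> Q \<rho> F \<psi>))) \<and>
      (\<forall>\<psi> :: 'e \<Rightarrow> real. mh_cv_var \<pi> Q \<rho> F F \<le> mh_cv_var \<pi> Q \<rho> F \<psi>) \<and>
      mh_cv_var \<pi> Q \<rho> F F \<le> mh_var \<pi> Q \<rho> F)"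
proof -
  interpret mh_process \<pi> Q \<rho> M X Xt
    using assms by (rule mh_process.intro)
  show ?thesis
    using poisson_solvable mh_cv_var_nonneg clt mh_cv_var_ge mh_cv_var_le by blast
qed

end
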